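(* Let $K$ be a field of characteristic different from $2$ and $3$. Any mock-Lie algebra over $K$ of dimension $\le 6$ is special.
   Context: A mock-Lie algebra over $K$ is a (not necessarily associative) $K$-algebra $L$ with bilinear multiplication $\circ$ which is commutative, $x\circ y=y\circ x$, and satisfies the Jacobi identity $(x\circ y)\circ z+(z\circ x)\circ y+(y\circ z)\circ x=0$ for all $x,y,z\in L$. (Every mock-Lie algebra is a Jordan algebra.) For an associative $K$-algebra $A$, $A^{(+)}$ denotes the algebra on the same vector space with multiplication $a\circ b=\frac12(ab+ba)$. A mock-Lie algebra $L$ is called special if there exist an associative $K$-algebra $A$ and an injective algebra homomorphism $L\to A^{(+)}$. *)

theory Defs
  imports Complex_Main "HOL-Library.Poly_Mapping"
begin

text \<open>Algebras are not assumed to be associative or to have a unit.\<close>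

locale nonassoc_algebra = vector_space scale
  for scale :: "'k::field \<Rightarrow> 'v::ab_group_add \<Rightarrow> 'v" +
  fixes mult :: "'v \<Rightarrow> 'v \<Rightarrow> 'v"
  assumes mult_add_left: "mult (x + y) z = mult x z + mult y z"
    and mult_add_right: "mult x (y + z) = mult x y + mult x z"
    and mult_scale_left: "mult (scale c x) y = scale c (mult x y)"
    and mult_scale_right: "mult x (scale c y) = scale c (mult x y)"

locale mock_lie_algebra = nonassoc_algebra scale mult
  for scale :: "'k::field \<Rightarrow> 'v::ab_group_add \<Rightarrow> 'v" and mult :: "'v \<Rightarrow> 'v \<Rightarrow> 'v" +
  assumes mult_commute: "mult x y = mult y x"
    and jacobi: "mult (mult x y) z + mult (mult z x) y + mult (mult y z) x = 0"

locale assoc_algebra = nonassoc_algebra scale mult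
  for scale :: "'k::field \<Rightarrow> 'v::ab_group_add \<Rightarrow> 'v" and mult :: "'v \<Rightarrow> 'v \<Rightarrow> 'v" +
  assumes mult_assoc: "mult (mult x y) z = mult x (mult y z)"

text \<open>The multiplication of \<open>A\<^sup>(\<^sup>+\<^sup>)\<close>:\<close>

definition plus_mult ::
  "('k::field \<Rightarrow> 'a::ab_group_add \<Rightarrow> 'a) \<Rightarrow> ('a \<Rightarrow> 'a \<Rightarrow> 'a) \<Rightarrow> 'a \<Rightarrow> 'a \<Rightarrow> 'a" where
  "plus_mult scale mult a b = scale (1 / 2) (mult a b + mult b a)"

definition algebra_hom ::
  "('k::field \<Rightarrow> 'v::ab_group_add \<Rightarrow> 'v) \<Rightarrow> ('v \<Rightarrow> 'v \<Rightarrow> 'v) \<Rightarrow>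
   ('k \<Rightarrow> 'a::ab_group_add \<Rightarrow> 'a) \<Rightarrow> ('a \<Rightarrow> 'a \<Rightarrow> 'a) \<Rightarrow> ('v \<Rightarrow> 'a) \<Rightarrow> bool" where
  "algebra_hom s m s' m' f \<longleftrightarrow>
     Vector_Spaces.linear s s' f \<and> (\<forall>x y. f (m x y) = m' (f x) (f y))"

text \<open>
  HOL cannot quantify existentially over the type underlying the associative algebra \<open>A\<close>, so in
  \<open>special\<close> the underlying group of \<open>A\<close> is that of the free vector space on the words over \<open>L\<close>;
  its scalar multiplication and its product are arbitrary.  This is no restriction: by
  \<open>specialI\<close> below, an injective homomorphism into \<open>A\<^sup>(\<^sup>+\<^sup>)\<close> for an associative algebra \<open>A\<close> on any
  type yields one of this form.
\<close>

definition special ::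
  "('k::field \<Rightarrow> 'v::ab_group_add \<Rightarrow> 'v) \<Rightarrow> ('v \<Rightarrow> 'v \<Rightarrow> 'v) \<Rightarrow> bool" where
  "special scale mult \<longleftrightarrow>
     (\<exists>(scaleA :: 'k \<Rightarrow> ('v list \<Rightarrow>\<^sub>0 'k) \<Rightarrow> ('v list \<Rightarrow>\<^sub>0 'k)) multA \<phi>.
        assoc_algebra scaleA multA \<and>
        algebra_hom scale mult scaleA (plus_mult scaleA multA) \<phi> \<and> inj \<phi>)"

definition pm_scale :: "'k::field \<Rightarrow> ('i \<Rightarrow>\<^sub>0 'k) \<Rightarrow> ('i \<Rightarrow>\<^sub>0 'k)" where
  "pm_scale c = Poly_Mapping.map ((*) c)"

lemma lookup_pm_scale [simp]: "Poly_Mapping.lookup (pm_scale c f) i = c * Poly_Mapping.lookup f i"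
  unfolding pm_scale_def by (simp add: Poly_Mapping.map.rep_eq when_def)

lemma vector_space_pm_scale: "vector_space (pm_scale :: 'k::field \<Rightarrow> ('i \<Rightarrow>\<^sub>0 'k) \<Rightarrow> _)"
  by unfold_locales (auto intro!: poly_mapping_eqI simp: lookup_add algebra_simps)

fun word_value :: "('a \<Rightarrow> 'a \<Rightarrow> 'a) \<Rightarrow> ('v \<Rightarrow> 'a) \<Rightarrow> 'v list \<Rightarrow> 'a::zero" where
  "word_value m f [] = 0"
| "word_value m f [x] = f x"
| "word_value m f (x # y # zs) = m (f x) (word_value m f (y # zs))"

theorem specialI:
  fixes scale :: "'k::field \<Rightarrow> 'v::ab_group_add \<Rightarrow> 'v"
    and scaleA :: "'k \<Rightarrow> 'a::ab_group_add \<Rightarrow> 'a"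
  assumes A: "assoc_algebra scaleA multA"
    and hom: "algebra_hom scale mult scaleA (plus_mult scaleA multA) \<phi>"
    and inj: "inj \<phi>"
  shows "special scale mult"
proof -
  interpret A: assoc_algebra scaleA multA by fact
  interpret F: vector_space "pm_scale :: 'k \<Rightarrow> ('v list \<Rightarrow>\<^sub>0 'k) \<Rightarrow> _"
    by (rule vector_space_pm_scale)
  interpret FA: vector_space_pair "pm_scale :: 'k \<Rightarrow> ('v list \<Rightarrow>\<^sub>0 'k) \<Rightarrow> _" scaleA ..
  interpret \<phi>: Vector_Spaces.linear scale scaleA \<phi> using hom by (simp add: algebra_hom_def)
  let ?w = "word_value multA \<phi>"
  define \<Phi> where "\<Phi> f = (\<Sum>u\<in>Poly_Mapping.keys f. scaleA (Poly_Mapping.lookup f u) (?w u))"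
    for f :: "'v list \<Rightarrow>\<^sub>0 'k"
  have \<Phi>_sup: "\<Phi> f = (\<Sum>u\<in>S. scaleA (Poly_Mapping.lookup f u) (?w u))"
    if "finite S" "Poly_Mapping.keys f \<subseteq> S" for f S
    unfolding \<Phi>_def using that by (intro sum.mono_neutral_left) (auto simp: in_keys_iff)
  have lin: "Vector_Spaces.linear pm_scale scaleA \<Phi>"
  proof (unfold_locales, goal_cases)
    case (1 f g)
    let ?S = "Poly_Mapping.keys f \<union> Poly_Mapping.keys g"
    have "\<Phi> (f + g) = (\<Sum>u\<in>?S. scaleA (Poly_Mapping.lookup (f + g) u) (?w u))"
      by (rule \<Phi>_sup) (use Poly_Mapping.keys_add[of f g] in auto)
    moreover have "\<Phi> f = (\<Sum>u\<in>?S. scaleA (Poly_Mapping.lookup f u) (?w u))"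
      "\<Phi> g = (\<Sum>u\<in>?S. scaleA (Poly_Mapping.lookup g u) (?w u))"
      by (rule \<Phi>_sup; simp)+
    ultimately show ?case
      by (simp add: lookup_add A.scale_left_distrib sum.distrib)
  next
    case (2 c f)
    have "\<Phi> (pm_scale c f) =
        (\<Sum>u\<in>Poly_Mapping.keys f. scaleA (Poly_Mapping.lookup (pm_scale c f) u) (?w u))"
      by (rule \<Phi>_sup) (auto simp: in_keys_iff)
    then show ?case
      by (simp add: \<Phi>_def A.scale_sum_right)
  qed
  interpret \<Phi>: Vector_Spaces.linear pm_scale scaleA \<Phi> by (rule lin)
  have sub: "A.subspace (range \<Phi>)"
    by (rule \<Phi>.subspace_image) (rule F.subspace_UNIV)
  have word: "?w u \<in> range \<Phi>" for u
  proof -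
    have "\<Phi> (Poly_Mapping.single u 1) = ?w u"
      unfolding \<Phi>_def by (simp add: keys_single)
    then show ?thesis by (metis rangeI)
  qed
  have z: "multA 0 x = 0" "multA x 0 = 0" for x
    using A.mult_scale_left[of 0 0 x] A.mult_scale_right[of x 0 0] by simp_all
  have app: "multA (?w u) (?w v) = ?w (u @ v)" if "u \<noteq> []" "v \<noteq> []" for u v
    using that
  proof (induction u)
    case (Cons x u)
    then show ?case
      by (cases u; cases v) (auto simp: A.mult_assoc)
  qed simp
  have sl: "multA (sum g S) b = (\<Sum>i\<in>S. multA (g i) b)" for g :: "'v list \<Rightarrow> 'a" and S b
    by (induction S rule: infinite_finite_induct) (simp_all add: z A.mult_add_left)
  have sr: "multA b (sum g S) = (\<Sum>i\<in>S. multA b (g i))" for g :: "'v list \<Rightarrow> 'a" and S b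
    by (induction S rule: infinite_finite_induct) (simp_all add: z A.mult_add_right)
  have closed: "multA (\<Phi> f) (\<Phi> g) \<in> range \<Phi>" for f g
  proof -
    have ww: "multA (?w u) (?w v) \<in> range \<Phi>" for u v
    proof (cases "u = [] \<or> v = []")
      case True
      then show ?thesis using A.subspace_0[OF sub] by (auto simp: z)
    next
      case False
      then show ?thesis using app[of u v] word by simp
    qed
    show ?thesis
      unfolding \<Phi>_def[of f] \<Phi>_def[of g] sl sr A.mult_scale_left A.mult_scale_right
      by (intro A.subspace_sum[OF sub] A.subspace_scale[OF sub] ww)
  qed
  obtain \<iota> where \<iota>: "Vector_Spaces.linear scaleA pm_scale \<iota>" "\<And>x. \<Phi> (\<iota> (\<Phi> x)) = \<Phi> x"
    using FA.linear_exists_right_inverse_on[OF lin F.subspace_UNIV] by auto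
  interpret \<iota>: Vector_Spaces.linear scaleA pm_scale \<iota> by fact
  define multF where "multF f g = \<iota> (multA (\<Phi> f) (\<Phi> g))" for f g
  have inv: "\<Phi> (\<iota> x) = x" if "x \<in> range \<Phi>" for x
    using that \<iota>(2) by auto
  have F: "assoc_algebra pm_scale multF"
    by unfold_locales
      (simp_all add: multF_def \<Phi>.add \<Phi>.scale \<iota>.add \<iota>.scale A.mult_add_left A.mult_add_right
         A.mult_scale_left A.mult_scale_right inv closed A.mult_assoc)
  have im: "\<phi> x \<in> range \<Phi>" for x
    using word[of "[x]"] by simp
  have lin': "Vector_Spaces.linear scale pm_scale (\<iota> \<circ> \<phi>)"
    by (rule Vector_Spaces.linear_compose[OF \<phi>.linear_axioms \<iota>.linear_axioms])
  have "algebra_hom scale mult pm_scale (plus_mult pm_scale multF) (\<iota> \<circ> \<phi>)"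
    using hom lin' unfolding algebra_hom_def plus_mult_def
    by (simp add: multF_def inv im \<iota>.add \<iota>.scale)
  moreover have "inj (\<iota> \<circ> \<phi>)"
    by (rule injI) (metis comp_apply im inv inj injD)
  ultimately show ?thesis
    unfolding special_def using F by blast
qed

end

theory Submission
  imports Defs "HOL-Library.Function_Algebras" "HOL-Library.Product_Plus"
begin

text \<open>
  The dimension enters only through the claim that all products of four elements of \<open>L\<close> vanish,
  however they are bracketed.  Once this is known, \<open>L\<close> is special for a reason that no longer
  involves the Jacobi identity (\<open>special_if_commutative_class_three\<close>).  Suppose that \<open>L\<close> sits inside
  \<open>A\<^sup>(\<^sup>+\<^sup>)\<close>.  Then \<open>A\<close> also contains commutators, and in any associative algebra the Jordan product
  already determines the commutator of \<open>c\<close> with half a commutator \<open>\<omega> a b\<close>, where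
  \<open>\<omega> a b = [a, b] / 2\<close>: one has \<open>[c, \<omega> a b] / 2 = (a c) b - a (c b)\<close>, an element of \<open>L\<close>.  The Jordan
  product of \<open>c\<close> with \<open>\<omega> a b\<close> is skew of weight three and may be put equal to zero.  So commutators
  can be represented by the linear maps \<open>c \<mapsto> (a c) b - a (c b)\<close>, which kill products and take
  values that annihilate \<open>L\<close>, and \<open>L\<close> plus the space of such maps is the required \<open>A\<close>.

  For the vanishing of fourfold products, suppose that one of them is nonzero; then there are seven
  linearly independent vectors.  If \<open>(x y) (z w)\<close> is not identically zero, polarization gives \<open>a\<close>, \<open>b\<close>
  with \<open>(a a) (b b) \<noteq> 0\<close>, and \<open>a\<close>, \<open>b\<close> with their products of degree two and three do
  (\<open>relation_trivial_two_generators\<close>).  Otherwise left multiplications anticommute on \<open>L L\<close>, and a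
  nonzero \<open>a (b (c c))\<close> gives three generators, \<open>c c\<close> and three products of degree three
  (\<open>relation_trivial_three_generators\<close>).  In both cases multiplication into the degree of the nonzero
  fourfold product picks out the coefficients of a linear relation one after the other.
\<close>

section \<open>Linear algebra\<close>

lemma (in vector_space) linear_projection_onto:
  assumes "subspace S"
  obtains p where "Vector_Spaces.linear scale scale p" "\<And>x. p x \<in> S" "\<And>x. x \<in> S \<Longrightarrow> p x = x"
proof -
  interpret vector_space_pair scale scale ..
  have "Vector_Spaces.linear scale scale (\<lambda>x. x)"
    by unfold_locales auto
  from linear_exists_left_inverse_on[OF this assms] show ?thesis
    using that by (auto simp: inj_on_def image_subset_iff)
qed

text \<open>
  This makes the space of all functions usable in place of the space of linear maps that vanish on
  \<open>U\<close> and take values in \<open>T\<close>: an algebra has to live on a whole type, and a function enters its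
  product only through \<open>P\<close>.
\<close>

lemma (in vector_space) projection_onto_linear_maps:
  assumes U: "subspace U" and T: "subspace T"
  obtains P :: "('b \<Rightarrow> 'b) \<Rightarrow> 'b \<Rightarrow> 'b" where
    "\<And>f g. P (f + g) = P f + P g"
    "\<And>c f. P (\<lambda>x. scale c (f x)) = (\<lambda>x. scale c (P f x))"
    "\<And>f. Vector_Spaces.linear scale scale (P f)"
    "\<And>f x. x \<in> U \<Longrightarrow> P f x = 0"
    "\<And>f x. P f x \<in> T"
    "\<And>f. Vector_Spaces.linear scale scale f \<and> (\<forall>x\<in>U. f x = 0) \<and> (\<forall>x. f x \<in> T) \<longrightarrow> P f = f"
proof -
  interpret vp: vector_space_pair scale scale ..
  obtain q where q: "Vector_Spaces.linear scale scale q" "\<And>x. q x \<in> U" "\<And>x. x \<in> U \<Longrightarrow> q x = x"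
    by (rule linear_projection_onto[OF U]) (rule that)
  obtain p where p: "Vector_Spaces.linear scale scale p" "\<And>x. p x \<in> T" "\<And>x. x \<in> T \<Longrightarrow> p x = x"
    by (rule linear_projection_onto[OF T]) (rule that)
  interpret q: Vector_Spaces.linear scale scale q by fact
  interpret p: Vector_Spaces.linear scale scale p by fact
  obtain B where B: "independent B" "span B = UNIV"
    using independent_extend_basis[OF independent_empty] span_extend_basis[OF independent_empty] by blast
  define lin where "lin = vp.construct B"
  have lin_linear: "Vector_Spaces.linear scale scale (lin f)" for f
    unfolding lin_def by (rule vp.linear_construct[OF B(1)])
  have lin_id: "lin f = f" if "Vector_Spaces.linear scale scale f" for f
  proof
    show "lin f x = f x" for x
      by (rule vp.linear_eq_on[OF lin_linear that, of x B])
        (simp_all add: B lin_def vp.construct_basis)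
  qed
  define P where "P f x = p (lin f (x - q x))" for f x
  show ?thesis
  proof (rule that[of P])
    show "P (f + g) = P f + P g" for f g
      using vp.construct_add[OF B(1), of f g]
      by (auto simp: P_def fun_eq_iff plus_fun_def lin_def p.add)
    show "P (\<lambda>x. scale c (f x)) = (\<lambda>x. scale c (P f x))" for c f
      using vp.construct_scale[OF B(1), of c f]
      by (auto simp: P_def fun_eq_iff lin_def p.scale)
    show "Vector_Spaces.linear scale scale (P f)" for f
    proof -
      interpret l: Vector_Spaces.linear scale scale "lin f" by (rule lin_linear)
      show ?thesis
        by unfold_locales
          (simp_all add: P_def q.add q.scale l.add l.diff l.scale p.add p.diff p.scale algebra_simps)
    qed
    then show "P f x = 0" if "x \<in> U" for f x
      using that Vector_Spaces.linear.axioms(3)[OF lin_linear[of f]]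
      by (simp add: P_def q(3) module_hom.zero p.zero)
    show "P f x \<in> T" for f x
      by (simp add: P_def p)
    show "Vector_Spaces.linear scale scale f \<and> (\<forall>x\<in>U. f x = 0) \<and> (\<forall>x. f x \<in> T) \<longrightarrow> P f = f" for f
    proof (intro impI ext, elim conjE)
      fix x
      assume f: "Vector_Spaces.linear scale scale f" "\<forall>x\<in>U. f x = 0" "\<forall>x. f x \<in> T"
      interpret f: Vector_Spaces.linear scale scale f by fact
      show "P f x = f x"
        using f(2,3) by (simp add: P_def lin_id[OF f(1)] f.diff q(2) p(3))
    qed
  qed
qed

lemma (in finite_dimensional_vector_space) exists_linear_relation:
  fixes v :: "nat \<Rightarrow> 'b"
  assumes "dim UNIV < n"
  obtains c i where "i < n" "c i \<noteq> 0" "(\<Sum>j<n. scale (c j) (v j)) = 0"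
proof (cases "inj_on v {..<n}")
  case True
  have "dependent (v ` {..<n})"
  proof (rule ccontr)
    assume "\<not> dependent (v ` {..<n})"
    from independent_card_le_dim[OF subset_UNIV this] show False
      using assms card_image[OF True] by simp
  qed
  then obtain u where u: "\<exists>w\<in>v ` {..<n}. u w \<noteq> 0" "(\<Sum>w\<in>v ` {..<n}. scale (u w) w) = 0"
    using dependent_finite[of "v ` {..<n}"] by auto
  from u(2) have "(\<Sum>j<n. scale (u (v j)) (v j)) = 0"
    by (simp add: sum.reindex[OF True])
  with u(1) that[of _ "\<lambda>j. u (v j)"] show ?thesis by auto
next
  case False
  then obtain i k where ik: "i < n" "k < n" "i \<noteq> k" "v i = v k"
    by (auto simp: inj_on_def)
  define c :: "nat \<Rightarrow> 'a" where "c j = (if j = i then 1 else if j = k then - 1 else 0)" for j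
  have "(\<Sum>j<n. scale (c j) (v j)) = (\<Sum>j\<in>{i, k}. scale (c j) (v j))"
    by (rule sum.mono_neutral_right) (use ik in \<open>auto simp: c_def\<close>)
  also have "\<dots> = 0" using ik by (simp add: c_def)
  finally show ?thesis using that[of i c] ik by (simp add: c_def)
qed

section \<open>Commutative algebras of nilpotency class three\<close>

context nonassoc_algebra
begin

lemma mult_zero_left [simp]: "mult 0 x = 0"
  using mult_add_left[of 0 0 x] by simp

lemma mult_zero_right [simp]: "mult x 0 = 0"
  using mult_add_right[of x 0 0] by simp

lemma mult_minus_left [simp]: "mult (- x) y = - mult x y"
  using mult_add_left[of x "- x" y] by (simp add: eq_neg_iff_add_eq_0 add.commute)

lemma mult_minus_right [simp]: "mult x (- y) = - mult x y"
  using mult_add_right[of x y "- y"] by (simp add: eq_neg_iff_add_eq_0 add.commute)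

lemma mult_diff_left: "mult (x - y) z = mult x z - mult y z"
  using mult_add_left[of x "- y" z] by simp

lemma mult_diff_right: "mult z (x - y) = mult z x - mult z y"
  using mult_add_right[of z x "- y"] by simp

text \<open>
  The associative algebra has the elements \<open>(a, \<sigma>)\<close>, where \<open>\<sigma>\<close> stands for a sum of halved commutators
  and acts on \<open>L\<close> by \<open>c \<mapsto> [c, \<sigma>] / 2\<close>.  As every threefold product that involves such a \<open>\<sigma>\<close> together
  with two elements of \<open>L\<close> has weight four and is zero, associativity comes down to
  \<open>(a b) c - \<omega> a b c = a (b c) + \<omega> b c a\<close>, which is an identity in every commutative algebra.
\<close>

theorem special_if_commutative_class_three:
  assumes two: "(2 :: 'k) \<noteq> 0"
    and comm: "\<And>x y. mult x y = mult y x"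
    and four1: "\<And>a b c d. mult a (mult b (mult c d)) = 0"
    and four2: "\<And>a b c d. mult (mult a b) (mult c d) = 0"
  shows "special scale mult"
proof -
  define U where "U = span {mult a b | a b. True}"
  \<comment> \<open>Values must be products as well as annihilate \<open>L\<close>: only then do the maps compose to zero.\<close>
  define T where "T = {x \<in> U. \<forall>y. mult y x = 0}"
  have U: "subspace U" unfolding U_def by (rule subspace_span)
  have multU: "mult a b \<in> U" for a b
    unfolding U_def by (rule span_base) auto
  have T: "subspace T"
    using U by (auto simp: subspace_def T_def mult_add_right mult_scale_right)
  obtain P :: "('v \<Rightarrow> 'v) \<Rightarrow> 'v \<Rightarrow> 'v" where
    P_add: "\<And>f g. P (f + g) = P f + P g"
    and P_scale: "\<And>c f. P (\<lambda>x. scale c (f x)) = (\<lambda>x. scale c (P f x))"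
    and P_linear: "\<And>f. Vector_Spaces.linear scale scale (P f)"
    and P_U: "\<And>f x. x \<in> U \<Longrightarrow> P f x = 0"
    and P_T: "\<And>f x. P f x \<in> T"
    and P_id: "\<And>f. Vector_Spaces.linear scale scale f \<and> (\<forall>x\<in>U. f x = 0) \<and> (\<forall>x. f x \<in> T) \<longrightarrow> P f = f"
    by (rule projection_onto_linear_maps[OF U T]) (rule that)
  have P1: "P f (x + y) = P f x + P f y" "P f (x - y) = P f x - P f y"
    "P f (scale c x) = scale c (P f x)" for f x y c
  proof -
    interpret Vector_Spaces.linear scale scale "P f" by (rule P_linear)
    show "P f (x + y) = P f x + P f y" "P f (x - y) = P f x - P f y"
      "P f (scale c x) = scale c (P f x)" by (rule add diff scale)+
  qed
  have P_mult: "mult x (P f y) = 0" "mult (P f y) x = 0" "P g (P f y) = 0" "P g (mult x y) = 0" for f g x y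
    using P_T[of f y] comm[of x "P f y"] by (auto simp: T_def P_U multU)
  have P_0: "P (\<lambda>_. 0) = (\<lambda>_. 0)"
    using P_scale[of 0 "\<lambda>_. 0"] by simp
  define \<omega> where "\<omega> a b c = mult (mult a c) b - mult a (mult c b)" for a b c
  have P_\<omega>: "P (\<omega> a b) = \<omega> a b" for a b
  proof (rule P_id[rule_format], intro conjI ballI allI)
    show lin: "Vector_Spaces.linear scale scale (\<omega> a b)"
      by unfold_locales
        (simp_all add: \<omega>_def mult_add_left mult_add_right mult_scale_left mult_scale_right algebra_simps)
    show "\<omega> a b x \<in> T" for x
      using subspace_diff[OF U multU multU]
      by (auto simp: \<omega>_def T_def mult_diff_right four1 comm[of "mult a x" b])
    interpret Vector_Spaces.linear scale scale "\<omega> a b" by (rule lin)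
    show "\<omega> a b x = 0" if "x \<in> U" for x
      using that unfolding U_def
    proof (induction rule: span_induct_alt)
      case base show ?case by (rule zero)
    next
      case (step c x y)
      then obtain d e where "x = mult d e" by auto
      then have "\<omega> a b x = 0"
        using four1[of b a d e] four1[of a b d e]
        by (simp add: \<omega>_def comm[of "mult a (mult d e)" b] comm[of "mult d e" b])
      then show ?case using step by (simp add: add scale)
    qed
  qed
  have \<omega>_lin: "\<omega> (a + a') b = \<omega> a b + \<omega> a' b" "\<omega> a (b + b') = \<omega> a b + \<omega> a b'"
    "\<omega> (scale k a) b = (\<lambda>c. scale k (\<omega> a b c))" "\<omega> a (scale k b) = (\<lambda>c. scale k (\<omega> a b c))"
    for a a' b b' k
    by (auto simp: fun_eq_iff \<omega>_def mult_add_left mult_add_right mult_scale_left mult_scale_right algebra_simps)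
  have \<omega>_0: "\<omega> (mult a b) c = (\<lambda>_. 0)" "\<omega> c (mult a b) = (\<lambda>_. 0)"
    "\<omega> (P f a) c = (\<lambda>_. 0)" "\<omega> c (P f a) = (\<lambda>_. 0)" for a b c f
    using four1 four2 by (auto simp: fun_eq_iff \<omega>_def comm[of _ c] P_mult comm[of "mult a b"])
  have \<omega>_anti: "\<omega> b a c = - \<omega> a b c" for a b c
    by (simp add: \<omega>_def comm)
  define scaleA :: "'k \<Rightarrow> 'v \<times> ('v \<Rightarrow> 'v) \<Rightarrow> 'v \<times> ('v \<Rightarrow> 'v)"
    where "scaleA k x = (scale k (fst x), \<lambda>c. scale k (snd x c))" for k x
  define multA :: "'v \<times> ('v \<Rightarrow> 'v) \<Rightarrow> 'v \<times> ('v \<Rightarrow> 'v) \<Rightarrow> 'v \<times> ('v \<Rightarrow> 'v)"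
    where "multA x y = (mult (fst x) (fst y) + P (snd y) (fst x) - P (snd x) (fst y), \<omega> (fst x) (fst y))" for x y
  have A: "assoc_algebra scaleA multA"
  proof
    show "scaleA k (x + y) = scaleA k x + scaleA k y" for k x y
      by (simp add: scaleA_def prod_eq_iff fun_eq_iff algebra_simps)
    show "scaleA (k + l) x = scaleA k x + scaleA l x" for k l x
      by (simp add: scaleA_def prod_eq_iff fun_eq_iff algebra_simps)
    show "scaleA k (scaleA l x) = scaleA (k * l) x" for k l x
      by (simp add: scaleA_def)
    show "scaleA 1 x = x" for x
      by (simp add: scaleA_def)
    show "multA (x + y) z = multA x z + multA y z" for x y z
      by (simp add: multA_def prod_eq_iff P_add P1 \<omega>_lin mult_add_left)
    show "multA x (y + z) = multA x y + multA x z" for x y z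
      by (simp add: multA_def prod_eq_iff P_add P1 \<omega>_lin mult_add_right)
    show "multA (scaleA k x) y = scaleA k (multA x y)" for k x y
      by (simp add: multA_def scaleA_def P_scale P1 \<omega>_lin mult_scale_left algebra_simps)
    show "multA x (scaleA k y) = scaleA k (multA x y)" for k x y
      by (simp add: multA_def scaleA_def P_scale P1 \<omega>_lin mult_scale_right algebra_simps)
    show "multA (multA x y) z = multA x (multA y z)" for x y z
    proof -
      obtain a \<sigma> b \<tau> c \<upsilon> where xyz: "x = (a, \<sigma>)" "y = (b, \<tau>)" "z = (c, \<upsilon>)"
        by (metis surj_pair)
      have "mult (mult a b) c - \<omega> a b c = mult a (mult b c) + \<omega> b c a"
        by (simp add: \<omega>_def comm)
      moreover have "\<omega> (mult a b + P \<tau> a - P \<sigma> b) c = (\<lambda>_. 0)"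
        using \<omega>_0(1)[of a b c]
        by (simp add: fun_eq_iff \<omega>_def mult_add_left mult_diff_left P_mult)
      moreover have "\<omega> a (mult b c + P \<upsilon> b - P \<tau> c) = (\<lambda>_. 0)"
        using \<omega>_0(2)[of a b c]
        by (simp add: fun_eq_iff \<omega>_def mult_add_right mult_diff_right P_mult)
      ultimately show ?thesis
        by (simp add: xyz multA_def P_\<omega> P1 P_mult mult_add_left mult_diff_left mult_add_right mult_diff_right)
    qed
  qed
  have "algebra_hom scale mult scaleA (plus_mult scaleA multA) (\<lambda>a. (a, 0))"
    unfolding algebra_hom_def
  proof (intro conjI allI)
    interpret A: assoc_algebra scaleA multA by fact
    show "Vector_Spaces.linear scale scaleA (\<lambda>a. (a, 0))"
      by unfold_locales (simp_all add: scaleA_def zero_fun_def)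
    show "(mult a b, 0) = plus_mult scaleA multA (a, 0) (b, 0)" for a b
    proof -
      have "scale (1 / 2) (mult a b + mult b a) = scale (1 / 2 + 1 / 2) (mult a b)"
        by (simp only: comm[of b a] scale_left_distrib scale_right_distrib)
      also have "(1 / 2 + 1 / 2 :: 'k) = 1"
        using two by (simp add: field_simps)
      finally show ?thesis
        by (simp add: plus_mult_def multA_def scaleA_def zero_fun_def P_0 \<omega>_anti[of b a])
    qed
  qed
  moreover have "inj (\<lambda>a :: 'v. (a, 0 :: 'v \<Rightarrow> 'v))"
    by (rule injI) simp
  ultimately show ?thesis
    using specialI[OF A] by blast
qed

end

section \<open>Products of four elements in mock-Lie algebras\<close>

context mock_lie_algebra
begin

context
  assumes two: "(2 :: 'k) \<noteq> 0" and three: "(3 :: 'k) \<noteq> 0"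
begin

lemma double_cancel: "x + x = 0 \<Longrightarrow> x = (0 :: 'v)"
proof -
  assume "x + x = 0"
  then have "scale 2 x = 0"
    using scale_left_distrib[of 1 1 x] by simp
  then show "x = 0" using two by simp
qed

lemma neg_eq_self_iff [simp]: "- x = x \<longleftrightarrow> x = (0 :: 'v)"
  using double_cancel[of x] by (metis add.right_inverse neg_equal_0_iff_equal)

lemma neg_double_cancel: "- x - x = 0 \<Longrightarrow> x = (0 :: 'v)"
  by simp

lemma double_inject: "x + x = y + y \<Longrightarrow> x = (y :: 'v)"
  using double_cancel[of "x - y"] by (simp add: algebra_simps)

lemma jacobi': "mult x (mult y z) + mult y (mult x z) + mult (mult x y) z = 0"
  using jacobi[of x y z] by (simp add: mult_commute add_ac)

lemma cube_zero [simp]: "mult x (mult x x) = 0"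
proof -
  have "scale 3 (mult x (mult x x)) = 0"
    using jacobi[of x x x] scale_left_distrib[of 1 1 "mult x (mult x x)"]
      scale_left_distrib[of 2 1 "mult x (mult x x)"] by (simp add: mult_commute)
  then show ?thesis using three by simp
qed

lemma mult_sq: "mult (mult x x) y = - (mult x (mult x y) + mult x (mult x y))"
  using jacobi'[of x x y] by (simp only: eq_neg_iff_add_eq_0 add.commute)

lemma mult_sq': "mult y (mult x x) = - (mult x (mult x y) + mult x (mult x y))"
  using mult_sq by (simp add: mult_commute)

text \<open>
  Let \<open>M\<close> denote multiplication by \<open>x\<close>.  The Jacobi identity for \<open>x\<close>, \<open>x x\<close>, \<open>y\<close> says that
  multiplication by \<open>x x\<close>, which is \<open>- 2 M\<^sup>2\<close>, anticommutes with \<open>M\<close>, because \<open>x (x x) = 0\<close>.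
  Hence \<open>4 M\<^sup>3 = 0\<close>.
\<close>

lemma mult_left_cube [simp]: "mult x (mult x (mult x y)) = 0"
proof -
  define z where "z = mult x (mult x (mult x y))"
  have "mult (mult x x) (mult x y) = - (z + z)"
    by (simp only: mult_sq z_def)
  moreover have "mult x (mult (mult x x) y) = - (z + z)"
    by (simp only: mult_sq z_def mult_minus_right mult_add_right)
  moreover have "mult (mult x x) x = 0"
    using mult_commute[of "mult x x" x] by simp
  ultimately have "- (z + z) - (z + z) = 0"
    using jacobi'[of "mult x x" x y] by (simp del: minus_add_distrib)
  then show "mult x (mult x (mult x y)) = 0"
    unfolding z_def by - (rule double_cancel, rule neg_double_cancel)
qed

lemma polarize:
  assumes z: "\<And>x. h (mult x x) = 0" and add: "\<And>x y. h (x + y) = h x + (h y :: 'v)"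
  shows "h (mult x y) = 0"
proof -
  have "h (mult x y) + h (mult x y) = 0"
    using z[of "x + y"] z[of x] z[of y]
    by (simp add: mult_add_left mult_add_right add mult_commute[of y x])
  then show ?thesis by (rule double_cancel)
qed

text \<open>
  Put \<open>s = a (b (a b))\<close>, so that \<open>(a a) (b b) = 4 s\<close>.  Up to scalars, \<open>s\<close> is the only nonzero product
  of degree four in \<open>a\<close> and \<open>b\<close>, and \<open>a s = b s = 0\<close>.  Each of the seven vectors is carried to a
  nonzero multiple of \<open>s\<close> by some word in the multiplications by \<open>a\<close> and \<open>b\<close> that kills the vectors
  not yet dealt with.
\<close>

lemma relation_trivial_two_generators:
  assumes nz: "mult (mult a a) (mult b b) \<noteq> 0"
    and rel: "scale c0 a + scale c1 b + scale c2 (mult a a) + scale c3 (mult a b) + scale c4 (mult b b)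
      + scale c5 (mult a (mult a b)) + scale c6 (mult b (mult a b)) = 0" (is "?r = 0")
  shows "c0 = 0 \<and> c1 = 0 \<and> c2 = 0 \<and> c3 = 0 \<and> c4 = 0 \<and> c5 = 0 \<and> c6 = 0"
proof -
  define u where "u = mult a (mult a b)"
  define v where "v = mult b (mult a b)"
  define s where "s = mult a v"
  \<comment> \<open>Both sides are a quarter of \<open>(a a) (b b)\<close>, expanded from either factor.\<close>
  have bu: "mult b u = s"
  proof -
    have "mult b u + mult b u = s + s"
      unfolding s_def
    proof (rule double_inject)
      have "(mult b u + mult b u) + (mult b u + mult b u) = mult (mult b b) (mult a a)"
        by (subst mult_sq)
          (simp add: mult_sq'[of b a] u_def mult_add_right mult_diff_right algebra_simps)
      also have "\<dots> = mult (mult a a) (mult b b)"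
        by (rule mult_commute)
      also have "\<dots> = (mult a v + mult a v) + (mult a v + mult a v)"
        by (subst mult_sq)
          (simp add: mult_sq'[of a b] v_def mult_add_right mult_diff_right mult_commute[of b a] algebra_simps)
      finally show "(mult b u + mult b u) + (mult b u + mult b u)
          = (mult a v + mult a v) + (mult a v + mult a v)" .
    qed
    then show ?thesis by (rule double_inject)
  qed
  have "mult (mult a a) (mult b b) = (s + s) + (s + s)"
    by (subst mult_sq)
      (simp add: s_def mult_sq'[of a b] v_def mult_add_right mult_diff_right mult_commute[of b a] algebra_simps)
  then have s: "s \<noteq> 0" "s + s \<noteq> 0"
    using nz double_cancel[of s] by auto
  have t: "mult b a = mult a b" "mult a (mult a b) = u" "mult b (mult a b) = v"
    "mult a (mult b b) = - (v + v)" "mult b (mult a a) = - (u + u)"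
    "mult a u = 0" "mult b v = 0" "mult a v = s" "mult b u = s"
    by (simp_all add: u_def v_def s_def mult_sq' mult_commute[of b a] bu[unfolded u_def s_def v_def])
      (metis mult_commute mult_left_cube)+
  have as: "mult a s = 0"
  proof -
    have "mult a (mult a (mult a (mult b b))) = 0" by simp
    then show ?thesis by - (rule neg_double_cancel, simp add: t mult_diff_right)
  qed
  have bs: "mult b s = 0"
  proof -
    have "mult b (mult b (mult b (mult a a))) = 0" by simp
    then show ?thesis by - (rule neg_double_cancel, simp add: t mult_diff_right)
  qed
  note lin = mult_add_right mult_diff_right mult_scale_right t as bs
  from rel have 0: "mult a (mult b (mult b ?r)) = 0" "mult b (mult a (mult a ?r)) = 0"
     "mult b (mult b ?r) = 0" "mult a (mult a ?r) = 0" "mult a (mult b ?r) = 0"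
     "mult a ?r = 0" "mult b ?r = 0"
    by simp_all
  have c0: "c0 = 0" using 0(1) s by (simp add: lin)
  have c1: "c1 = 0" using 0(2) s by (simp add: lin)
  have c2: "c2 = 0" using 0(3) s c0 c1 by (simp add: lin flip: scale_right_distrib)
  have c4: "c4 = 0" using 0(4) s c0 c1 by (simp add: lin flip: scale_right_distrib)
  have c3: "c3 = 0" using 0(5) s c0 c1 c2 c4 by (simp add: lin)
  have c5: "c5 = 0" using 0(7) s c0 c1 c2 c3 c4 by (simp add: lin)
  have c6: "c6 = 0" using 0(6) s c0 c1 c2 c3 c4 by (simp add: lin)
  show ?thesis using c0 c1 c2 c3 c4 c5 c6 by simp
qed

text \<open>
  When products of products vanish, the Jacobi identity makes multiplications anticommute on products,
  so their squares vanish there.  Put \<open>s = a (c (b c))\<close>, so that \<open>a (b (c c)) = - 2 s\<close>.  As before,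
  words in the multiplications single out the coefficients; the products \<open>u\<close>, \<open>w\<close>, \<open>y\<close> of degree
  three are told apart by multiplying them by \<open>a\<close>, \<open>b\<close>, \<open>c\<close>, where the value of \<open>b y\<close> is unknown
  and therefore the coefficient of \<open>y\<close> has to be found before that of \<open>w\<close>.
\<close>

lemma relation_trivial_three_generators:
  assumes meta: "\<And>x y z w. mult (mult x y) (mult z w) = 0"
    and nz: "mult a (mult b (mult c c)) \<noteq> 0"
    and rel: "scale c0 a + scale c1 b + scale c2 c + scale c3 (mult c c) + scale c4 (mult c (mult b c))
      + scale c5 (mult c (mult a c)) + scale c6 (mult a (mult b c)) = 0" (is "?r = 0")
  shows "c0 = 0 \<and> c1 = 0 \<and> c2 = 0 \<and> c3 = 0 \<and> c4 = 0 \<and> c5 = 0 \<and> c6 = 0"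
proof -
  have anti: "mult x (mult y (mult z w)) = - mult y (mult x (mult z w))" for x y z w
    using jacobi'[of x y "mult z w"] by (simp add: meta eq_neg_iff_add_eq_0)
  have sq: "mult x (mult x (mult z w)) = 0" for x z w
    using anti[of x x z w] by - (rule double_cancel, simp add: eq_neg_iff_add_eq_0)
  define u where "u = mult c (mult b c)"
  define w where "w = mult c (mult a c)"
  define y where "y = mult a (mult b c)"
  define s where "s = mult a u"
  have bcc: "mult b (mult c c) = - (u + u)" and acc: "mult a (mult c c) = - (w + w)"
    by (simp_all add: mult_sq'[of _ c] u_def w_def mult_commute[of c a] mult_commute[of c b])
  have s: "s \<noteq> 0" "s + s \<noteq> 0"
    using nz double_cancel[of s] by (auto simp: bcc mult_diff_right s_def)
  have bu: "mult b u = 0"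
    using sq[of b c c] by - (rule neg_double_cancel, simp add: bcc mult_diff_right)
  have aw: "mult a w = 0"
    using sq[of a c c] by - (rule neg_double_cancel, simp add: acc mult_diff_right)
  have bw: "mult b w = - s"
  proof -
    have "- (mult b w + mult b w) = - (- (s + s))"
      using anti[of b a c c] by (simp only: acc bcc mult_minus_right mult_add_right s_def)
    then have "mult b w + mult b w = - s + - s"
      by (simp only: neg_equal_iff_equal) (simp only: minus_add_distrib)
    then show ?thesis by (rule double_inject)
  qed
  have cu: "mult c u = 0" and cw: "mult c w = 0" and ay: "mult a y = 0"
    unfolding u_def w_def y_def by (rule sq)+
  have cy: "mult c y = - s"
    unfolding s_def u_def y_def by (rule anti)
  have aby: "mult a (mult b y) = 0"
    using anti[of a b a "mult b c"] ay by (simp add: y_def)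
  have cs: "mult c s = 0"
    unfolding s_def u_def using anti[of c a c "mult b c"] by (simp add: sq)
  have as: "mult a s = 0"
    unfolding s_def u_def by (rule sq)
  have bs: "mult b s = 0"
    unfolding s_def using anti[of b a c "mult b c"] bu by (simp add: u_def)
  have t: "mult c a = mult a c" "mult c b = mult b c"
    "mult a (mult b c) = y" "mult c (mult b c) = u" "mult c (mult a c) = w"
    by (simp_all add: u_def w_def y_def mult_commute[of c a] mult_commute[of c b])
  note lin = mult_add_right mult_diff_right mult_scale_right t bcc acc bu aw bw cu cw ay cy aby cs as bs s_def[symmetric]
  from rel have 0: "mult b (mult c (mult c ?r)) = 0" "mult a (mult c (mult c ?r)) = 0"
     "mult a (mult b (mult c ?r)) = 0" "mult a (mult b ?r) = 0"
     "mult a ?r = 0" "mult c ?r = 0" "mult b ?r = 0"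
    by simp_all
  have c0: "c0 = 0" using 0(1) s by (simp add: lin)
  have c1: "c1 = 0" using 0(2) s by (simp add: lin)
  have c2: "c2 = 0" using 0(3) s c0 c1 by (simp add: lin flip: scale_right_distrib)
  have c3: "c3 = 0" using 0(4) s c0 c1 c2 by (simp add: lin flip: scale_right_distrib)
  have c4: "c4 = 0" using 0(5) s c0 c1 c2 c3 by (simp add: lin)
  have c6: "c6 = 0" using 0(6) s c0 c1 c2 c3 by (simp add: lin)
  have c5: "c5 = 0" using 0(7) s c0 c1 c2 c3 c6 by (simp add: lin)
  show ?thesis using c0 c1 c2 c3 c4 c5 c6 by simp
qed

lemma fourfold_products_zero:
  assumes fin: "finite_dimensional_vector_space scale Basis" and dim: "dim UNIV \<le> 6"
  shows "mult (mult x y) (mult z w) = 0" and "mult x (mult y (mult z w)) = 0"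
proof -
  interpret fd: finite_dimensional_vector_space scale Basis by fact
  have independent_absurd: False
    if triv: "\<And>c0 c1 c2 c3 c4 c5 c6. scale c0 v0 + scale c1 v1 + scale c2 v2 + scale c3 v3 + scale c4 v4
      + scale c5 v5 + scale c6 v6 = 0 \<Longrightarrow>
      c0 = 0 \<and> c1 = 0 \<and> c2 = 0 \<and> c3 = 0 \<and> c4 = 0 \<and> c5 = 0 \<and> c6 = 0"
    for v0 v1 v2 v3 v4 v5 v6
  proof -
    have "dim UNIV < 7" using dim by simp
    then obtain c i where c: "i < 7" "c i \<noteq> 0"
      "(\<Sum>j<7. scale (c j) ([v0, v1, v2, v3, v4, v5, v6] ! j)) = 0"
      by (rule fd.exists_linear_relation)
    have sum7: "(\<Sum>j<7. h j) = h 0 + h 1 + h 2 + h 3 + h 4 + h 5 + h 6" for h :: "nat \<Rightarrow> 'v"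
      by (simp add: eval_nat_numeral)
    have "c 0 = 0 \<and> c 1 = 0 \<and> c 2 = 0 \<and> c 3 = 0 \<and> c 4 = 0 \<and> c 5 = 0 \<and> c 6 = 0"
      by (rule triv) (use c(3) in \<open>simp add: sum7\<close>)
    moreover have "i \<in> {0, 1, 2, 3, 4, 5, 6}" using c(1) by auto
    ultimately show False using c(2) by auto
  qed
  have sq: "mult (mult a a) (mult b b) = 0" for a b
  proof (rule ccontr)
    assume nz: "mult (mult a a) (mult b b) \<noteq> 0"
    show False
      by (rule independent_absurd, rule relation_trivial_two_generators[OF nz])
  qed
  have "mult (mult a a) (mult z w) = 0" for a z w
    by (rule polarize[of "mult (mult a a)"]) (simp_all add: sq mult_add_right)
  then have meta: "mult (mult x y) (mult z w) = 0" for x y z w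
    by (rule polarize[of "\<lambda>p. mult p (mult z w)"]) (simp_all add: mult_add_left)
  then show "mult (mult x y) (mult z w) = 0" .
  have "mult a (mult b (mult c c)) = 0" for a b c
  proof (rule ccontr)
    assume nz: "mult a (mult b (mult c c)) \<noteq> 0"
    show False
      by (rule independent_absurd, rule relation_trivial_three_generators[OF meta nz])
  qed
  then show "mult x (mult y (mult z w)) = 0"
    by (rule polarize[of "\<lambda>p. mult x (mult y p)"]) (simp_all add: mult_add_right)
qed

end

end

theorem mainTheorem3:
  fixes scale :: "'k::field \<Rightarrow> 'v::ab_group_add \<Rightarrow> 'v"
    and mult :: "'v \<Rightarrow> 'v \<Rightarrow> 'v"
    and Basis :: "'v set"
  assumes "CHAR('k) \<noteq> 2" and "CHAR('k) \<noteq> 3"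
    and "mock_lie_algebra scale mult"
    and "finite_dimensional_vector_space scale Basis"
    and "vector_space.dim scale (UNIV :: 'v set) \<le> 6"
  shows "special scale mult"
proof -
  interpret mock_lie_algebra scale mult by fact
  have two: "(2 :: 'k) \<noteq> 0"
  proof
    assume "(2 :: 'k) = 0"
    then have "CHAR('k) dvd 2" using of_nat_eq_0_iff_char_dvd[where 'a = 'k, of 2] by simp
    then have "CHAR('k) \<noteq> 0" "CHAR('k) \<le> 2"
      using dvd_pos_nat[of 2 "CHAR('k)"] by (auto dest: dvd_imp_le)
    moreover have "CHAR('k) \<noteq> 1" by simp
    ultimately show False using assms(1) by simp
  qed
  have three: "(3 :: 'k) \<noteq> 0"
  proof
    assume "(3 :: 'k) = 0"
    then have "CHAR('k) dvd 3" using of_nat_eq_0_iff_char_dvd[where 'a = 'k, of 3] by simp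
    then have "CHAR('k) \<noteq> 0" "CHAR('k) \<le> 3"
      using dvd_pos_nat[of 3 "CHAR('k)"] by (auto dest: dvd_imp_le)
    moreover have "CHAR('k) \<noteq> 1" by simp
    ultimately show False using assms(1,2) by simp
  qed
  show ?thesis
    by (rule special_if_commutative_class_three[OF two mult_commute])
      (rule fourfold_products_zero[OF two three assms(4,5)])+
qed

end
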